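(* Let $N\ge 2$ be the number of phases and, for $1\le q\le N$, let $\alpha_q,\rho_q,\gamma_q,C_q^V,P_q,P_q^\infty$ be real numbers with $(\alpha_q\rho_q)\ge 0$, $0\le\alpha_q\le1$, $\sum_{q=1}^N\alpha_q=1$, $\gamma_q>1$, $C_q^V>0$ and $P_q\ge P_q^{\min}:=-P_q^\infty$, with the phases ordered so that $P_1^{\min}\ge P_2^{\min}\ge\dots\ge P_N^{\min}$. Define $$\mathcal N^{PT}(\mathcal P)=\sum_{q=1}^N\big((\mathcal P+P_q^\infty)+(\gamma_q-1)P_q^\infty\big)C_q^V(\alpha_q\rho_q)\prod_{k=1,k\ne q}^N(\mathcal P+P_k^\infty),$$ $$\mathcal G^{PT}(\mathcal P)=\sum_{q=1}^N C_q^V(\gamma_q-1)(\alpha_q\rho_q)\prod_{k=1,k\ne q}^N(\mathcal P+P_k^\infty),$$ $$\mathcal F^{PT}(\mathcal P)=\frac{\mathcal N^{PT}(\mathcal P)}{\mathcal G^{PT}(\mathcal P)}-\sum_{q=1}^N\frac{(P_q+P_q^\infty)+(\gamma_q-1)P_q^\infty}{\gamma_q-1}\,\alpha_q.$$ Denote by $P_{p,p+1}^c\in[P_{p+1}^{\min},P_p^{\min}]$, $1\le p\le N-1$, the roots of $\mathcal G^{PT}(\mathcal P)=0$. Then $\mathcal F^{PT}(\mathcal P)=0$ has $N$ real roots in $(-\infty,P_{N-1,N}^c)$, $(P_{p+1,p+2}^c,P_{p,p+1}^c)$ for $1\le p\le N-2$, and $(P_{1,2}^c,+\infty)$, with precisely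 one root per interval.
   Context: Setting: an $N$-phase mixture. Phase $q$ has volume fraction $\alpha_q$, density $\rho_q$, mass $(\alpha_q\rho_q)$, pressure $P_q$, temperature $T_q$ and specific internal energy $e_q$, with equation of state $\rho_q(e_q-e_q^\infty)=\frac{P_q+\gamma_q P_q^\infty}{\gamma_q-1}=\rho_q C_q^V T_q+P_q^\infty$, where $\gamma_q$, $P_q^\infty$, $C_q^V$, $e_q^\infty$ are material-dependent parameters. The number $P_q^{\min}=-P_q^\infty$ is the minimal admissible pressure of phase $q$. The state before relaxation is assumed thermodynamically admissible, which gives the stated inequalities on $(\alpha_q\rho_q)$, $\alpha_q$ and $P_q$. The common pressure after instantaneous pressure-temperature relaxation is a zero of $\mathcal F^{PT}$. It is established beforehand that $\mathcal G^{PT}(\mathcal P)=0$ has $N-1$ real roots in $[P_{p+1}^{\min},P_p^{\min}]$, $1\le p\le N-1$, with precisely one root per interval; these are the $P_{p,p+1}^c$.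
   Formalization: All masses (α_qρ_q) are taken nonzero and the P_q^min pairwise distinct; if a mass vanishes or two P_q^min coincide, a factor cancels in N^PT/G^PT and F^PT has at most N−1 roots (or is undefined), so the claim fails there. *)

theory Defs
  imports Complex_Main
begin

text \<open>
  Phases are numbered \<open>1, \<dots>, N\<close>; phase-indexed data are functions on \<open>nat\<close>, of which only the
  values on \<open>{1..N}\<close> matter. The mass \<open>(\<alpha>\<^sub>q \<rho>\<^sub>q)\<close> of phase \<open>q\<close> is the product \<open>\<alpha> q * \<rho> q\<close>.
\<close>

definition P_min :: "(nat \<Rightarrow> real) \<Rightarrow> nat \<Rightarrow> real"
  where "P_min Pinf q = - Pinf q"

definition N_PT ::
  "nat \<Rightarrow> (nat \<Rightarrow> real) \<Rightarrow> (nat \<Rightarrow> real) \<Rightarrow> (nat \<Rightarrow> real) \<Rightarrow> (nat \<Rightarrow> real) \<Rightarrow> (nat \<Rightarrow> real)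
    \<Rightarrow> real \<Rightarrow> real"
  where "N_PT N \<alpha> \<rho> \<gamma> CV Pinf x =
    (\<Sum>q = 1..N. ((x + Pinf q) + (\<gamma> q - 1) * Pinf q) * CV q * (\<alpha> q * \<rho> q)
       * (\<Prod>k \<in> {1..N} - {q}. x + Pinf k))"

definition G_PT ::
  "nat \<Rightarrow> (nat \<Rightarrow> real) \<Rightarrow> (nat \<Rightarrow> real) \<Rightarrow> (nat \<Rightarrow> real) \<Rightarrow> (nat \<Rightarrow> real) \<Rightarrow> (nat \<Rightarrow> real)
    \<Rightarrow> real \<Rightarrow> real"
  where "G_PT N \<alpha> \<rho> \<gamma> CV Pinf x =
    (\<Sum>q = 1..N. CV q * (\<gamma> q - 1) * (\<alpha> q * \<rho> q) * (\<Prod>k \<in> {1..N} - {q}. x + Pinf k))"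

text \<open>
  The argument \<open>P\<close> holds the phase pressures before relaxation. The value of \<open>F_PT\<close> is meaningful
  only where \<open>G_PT\<close> does not vanish (at a zero of \<open>G_PT\<close> the quotient is \<open>0\<close> by convention).
\<close>

definition F_PT ::
  "nat \<Rightarrow> (nat \<Rightarrow> real) \<Rightarrow> (nat \<Rightarrow> real) \<Rightarrow> (nat \<Rightarrow> real) \<Rightarrow> (nat \<Rightarrow> real) \<Rightarrow> (nat \<Rightarrow> real)
    \<Rightarrow> (nat \<Rightarrow> real) \<Rightarrow> real \<Rightarrow> real"
  where "F_PT N \<alpha> \<rho> \<gamma> CV P Pinf x =
    N_PT N \<alpha> \<rho> \<gamma> CV Pinf x / G_PT N \<alpha> \<rho> \<gamma> CV Pinf x
    - (\<Sum>q = 1..N. ((P q + Pinf q) + (\<gamma> q - 1) * Pinf q) / (\<gamma> q - 1) * \<alpha> q)"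

end

(*
  Write a_k for the shift P_k^inf, Q(x) for the product of all x + a_k, and G for G_PT.
  The identity x + gamma a = gamma (x + a) - (gamma - 1) x gives N_PT = V Q - x G with
  V = sum gamma_q C_q m_q, so off the zeros of G the equation F_PT = 0 reads
  H(x) = (x + K) G(x) - V Q(x) = 0, with K the constant subtracted in F_PT.  At the critical
  pressure Pc_p one has H = -V Q, whose sign alternates with p.  Since V exceeds the sum of the
  weights of G, H/Q has a negative limit at both infinities, so the alternation persists in the
  two unbounded intervals.  This gives a zero of H in each of N disjoint intervals, and H is a
  polynomial of degree at most N.
*)
theory Submission
  imports Defs "HOL-Library.Disjoint_Sets" "HOL-Computational_Algebra.Polynomial"
    "HOL-Real_Asymp.Real_Asymp"
begin

section \<open>Counting roots over disjoint sets, and signs of products of shifts\<close>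

lemma card_roots_eq_and_unique_per_set:
  fixes Z :: "'a set" and I :: "'i \<Rightarrow> 'a set"
  assumes "finite A" "finite Z" and "card Z \<le> card A"
    and ex: "\<And>p. p \<in> A \<Longrightarrow> \<exists>x. x \<in> Z \<inter> I p"
    and disj: "disjoint_family_on I A"
  shows "card Z = card A" and "\<And>p. p \<in> A \<Longrightarrow> \<exists>!x. x \<in> Z \<inter> I p"
proof -
  obtain r where r: "\<And>p. p \<in> A \<Longrightarrow> r p \<in> Z \<inter> I p"
    using ex by metis
  have eq: "p = q" if "p \<in> A" "q \<in> A" "x \<in> I p" "x \<in> I q" for p q x
    using disjoint_family_onD[OF disj that(1,2)] that(3,4) by blast
  have inj: "inj_on r A"
  proof (rule inj_onI)
    fix p q assume "p \<in> A" "q \<in> A" "r p = r q"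
    then show "p = q" using eq[of p q "r p"] r[of p] r[of q] by simp
  qed
  have sub: "r ` A \<subseteq> Z" using r by blast
  \<comment> \<open>Pigeonhole: one representative per set already gives \<open>card A\<close>
    distinct elements of \<open>Z\<close>, and \<open>Z\<close> has no more than that.\<close>
  have Z: "r ` A = Z"
    using card_image[OF inj] assms(2,3) sub by (intro card_seteq) auto
  then show "card Z = card A" using card_image[OF inj] by simp
  fix p assume p: "p \<in> A"
  show "\<exists>!x. x \<in> Z \<inter> I p"
  proof (rule ex1I[of _ "r p"])
    fix x assume x: "x \<in> Z \<inter> I p"
    then obtain s where s: "s \<in> A" "x = r s" using Z by blast
    then have "s = p" using eq[of s p x] r[OF s(1)] p x by simp
    then show "x = r p" using s by simp
  qed (use r p in blast)
qed

lemma degree_prod_linear: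
  fixes a :: "'i \<Rightarrow> real"
  shows "degree (\<Prod>k\<in>A. [:a k, 1:]) \<le> card A"
proof (cases "finite A")
  case True
  have "degree (\<Prod>k\<in>A. [:a k, 1:]) \<le> (\<Sum>k\<in>A. degree [:a k, 1:])"
    using degree_prod_sum_le[OF True, of "\<lambda>k. [:a k, 1:]"] by (simp add: o_def)
  then show ?thesis by simp
qed simp

text \<open>The negative factors form an initial block of length \<open>p\<close>, so
  \<open>(-1) ^ p\<close> is absorbed by negating each of them, and all factors become
  positive.\<close>

lemma sgn_prod_shift:
  fixes a :: "nat \<Rightarrow> real"
  assumes "p \<le> N" and "\<And>k. k \<in> {1..p} \<Longrightarrow> x + a k < 0"
    and "\<And>k. k \<in> {p + 1..N} \<Longrightarrow> x + a k > 0"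
  shows "(-1) ^ p * (\<Prod>k = 1..N. x + a k) > 0"
proof -
  have "(\<Prod>k = 1..N. x + a k) = (\<Prod>k = 1..p. x + a k) * (\<Prod>k = p + 1..N. x + a k)"
    using assms(1) prod.ub_add_nat[of 1 p "\<lambda>k. x + a k" "N - p"] by simp
  moreover have "(-1) ^ p * (\<Prod>k = 1..p. x + a k) = (\<Prod>k = 1..p. - (x + a k))"
    using prod_uminus[of "\<lambda>k. x + a k" "{1..p}"] by simp
  moreover have "(\<Prod>k = 1..p. - (x + a k)) > 0"
    by (intro prod_pos) (use assms(2) in force)
  moreover have "(\<Prod>k = p + 1..N. x + a k) > 0"
    by (intro prod_pos) (use assms(3) in blast)
  ultimately show ?thesis by (metis mult.assoc mult_pos_pos)
qed

section \<open>The product \<open>Q\<close>, the weighted sum \<open>G\<close> and their lack of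
  common zeros\<close>

locale weighted_shifts =
  fixes N :: nat and a w :: "nat \<Rightarrow> real"
  assumes N_ge_2: "N \<ge> 2"
    and a_less: "\<And>i j. 1 \<le> i \<Longrightarrow> i < j \<Longrightarrow> j \<le> N \<Longrightarrow> a i < a j"
    and w_pos: "\<And>q. q \<in> {1..N} \<Longrightarrow> w q > 0"
begin

definition Q :: "real \<Rightarrow> real" where
  "Q x = (\<Prod>k = 1..N. x + a k)"

definition G :: "real \<Rightarrow> real" where
  "G x = (\<Sum>q = 1..N. w q * (\<Prod>k \<in> {1..N} - {q}. x + a k))"

definition Q_poly :: "real poly" where
  "Q_poly = (\<Prod>k = 1..N. [:a k, 1:])"

definition G_poly :: "real poly" where
  "G_poly = (\<Sum>q = 1..N. smult (w q) (\<Prod>k \<in> {1..N} - {q}. [:a k, 1:]))"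

lemma poly_Q_poly: "poly Q_poly x = Q x"
  by (simp add: Q_poly_def Q_def poly_prod add.commute)

lemma poly_G_poly: "poly G_poly x = G x"
  by (simp add: G_poly_def G_def poly_sum poly_prod add.commute)

lemma degree_Q_poly: "degree Q_poly \<le> N"
  unfolding Q_poly_def using degree_prod_linear[of a "{1..N}"] by simp

lemma degree_G_poly: "degree G_poly \<le> N - 1"
  unfolding G_poly_def
proof (rule degree_sum_le)
  fix q assume q: "q \<in> {1..N}"
  have "degree (smult (w q) (\<Prod>k \<in> {1..N} - {q}. [:a k, 1:])) \<le> card ({1..N} - {q})"
    using degree_smult_le degree_prod_linear order_trans by blast
  then show "degree (smult (w q) (\<Prod>k \<in> {1..N} - {q}. [:a k, 1:])) \<le> N - 1"
    using q by simp
qed simp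

lemma Q_eq_mult: "q \<in> {1..N} \<Longrightarrow> Q x = (x + a q) * (\<Prod>k \<in> {1..N} - {q}. x + a k)"
  unfolding Q_def by (rule prod.remove) auto

text \<open>The points \<open>- a q\<close> are the poles of \<open>G x / Q x\<close>. At
  \<open>- a p\<close> every summand with \<open>q\<close> different from \<open>p\<close> contains
  the vanishing factor \<open>k = p\<close>; the remaining one is nonzero because the shifts are
  distinct and \<open>w p > 0\<close>.\<close>

lemma G_neq_0_at_pole:
  assumes p: "p \<in> {1..N}"
  shows "G (- a p) \<noteq> 0"
proof -
  have "(\<Prod>k \<in> {1..N} - {q}. - a p + a k) = 0" if "q \<in> {1..N} - {p}" for q
    using that p by (intro prod_zero) auto
  then have "(\<Sum>q \<in> {1..N} - {p}. w q * (\<Prod>k \<in> {1..N} - {q}. - a p + a k)) = 0"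
    by (intro sum.neutral) simp
  then have "G (- a p) = w p * (\<Prod>k \<in> {1..N} - {p}. - a p + a k)"
    unfolding G_def using p by (subst sum.remove[of _ p]) simp_all
  moreover have "- a p + a k \<noteq> 0" if "k \<in> {1..N} - {p}" for k
    using that p a_less[of p k] a_less[of k p] by (cases "k < p") auto
  ultimately show ?thesis using w_pos[OF p] by simp
qed

lemma Q_eq_0D: "Q x = 0 \<Longrightarrow> G x \<noteq> 0"
  using G_neq_0_at_pole unfolding Q_def by (auto simp: add_eq_0_iff2)

text \<open>Partial fractions of \<open>G x / Q x\<close>, used below for the limits at
  infinity.\<close>

lemma G_eq_Q_mult:
  assumes "Q x \<noteq> 0"
  shows "G x = Q x * (\<Sum>q = 1..N. w q / (x + a q))"
proof -
  have "w q * (\<Prod>k \<in> {1..N} - {q}. x + a k) = Q x * (w q / (x + a q))" if q: "q \<in> {1..N}" for q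
    using Q_eq_mult[OF q, of x] assms by auto
  then show ?thesis unfolding G_def by (simp add: sum_distrib_left)
qed

end

section \<open>The cleared numerator \<open>H\<close>, the intervals and the signs at the critical
  pressures\<close>

locale weighted_shifts_roots = weighted_shifts +
  fixes Pc :: "nat \<Rightarrow> real" and V K :: real
  assumes Pc_range: "\<And>p. p \<in> {1..N - 1} \<Longrightarrow> Pc p \<in> {- a (p + 1)..- a p}"
    and Pc_root: "\<And>p. p \<in> {1..N - 1} \<Longrightarrow> G (Pc p) = 0"
    and V_gt: "V > (\<Sum>q = 1..N. w q)"
begin

definition H :: "real \<Rightarrow> real" where
  "H x = (x + K) * G x - V * Q x"

definition H_poly :: "real poly" where
  "H_poly = [:K, 1:] * G_poly - smult V Q_poly"

text \<open>Intervals are numbered from right to left, so \<open>cell 1\<close> is unbounded above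
  and \<open>cell N\<close> unbounded below. The guards drop the missing bound, which lets all
  \<open>N\<close> intervals be treated uniformly.\<close>

definition cell :: "nat \<Rightarrow> real set" where
  "cell p = {x. (p < N \<longrightarrow> Pc p < x) \<and> (1 < p \<longrightarrow> x < Pc (p - 1))}"

lemma V_pos: "V > 0"
proof -
  have "(\<Sum>q = 1..N. w q) \<ge> 0" using w_pos by (intro sum_nonneg) (auto intro: less_imp_le)
  then show ?thesis using V_gt by simp
qed

lemma poly_H_poly: "poly H_poly x = H x"
  by (simp add: H_poly_def H_def poly_G_poly poly_Q_poly algebra_simps)

lemma degree_H_poly: "degree H_poly \<le> N"
proof -
  have "degree ([:K, 1:] * G_poly) \<le> degree [:K, 1:] + degree G_poly"
    by (rule degree_mult_le)
  also have "\<dots> \<le> N" using degree_G_poly N_ge_2 by simp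
  finally show ?thesis
    unfolding H_poly_def
    by (rule degree_diff_le) (use degree_smult_le degree_Q_poly order_trans in blast)
qed

text \<open>Clearing the denominator creates no spurious roots: a common zero of \<open>H\<close>
  and \<open>G\<close> would be a zero of \<open>V * Q x\<close>, hence of \<open>Q\<close>, where
  \<open>G\<close> does not vanish.\<close>

lemma H_eq_0D: "H x = 0 \<Longrightarrow> G x \<noteq> 0"
  using Q_eq_0D[of x] V_pos by (auto simp: H_def)

text \<open>The ends of the closed interval are poles, where \<open>G\<close> is nonzero.\<close>

lemma Pc_strict:
  assumes p: "p \<in> {1..N - 1}"
  shows "- a (p + 1) < Pc p" "Pc p < - a p"
proof -
  have "Pc p \<noteq> - a (p + 1)" "Pc p \<noteq> - a p"
    using Pc_root[OF p] G_neq_0_at_pole[of p] G_neq_0_at_pole[of "p + 1"] p by auto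
  then show "- a (p + 1) < Pc p" "Pc p < - a p" using Pc_range[OF p] by auto
qed

lemma a_mono: "1 \<le> i \<Longrightarrow> i \<le> j \<Longrightarrow> j \<le> N \<Longrightarrow> a i \<le> a j"
  using a_less[of i j] by (cases "i = j") auto

lemma Pc_less:
  assumes "1 \<le> i" "i < j" "j \<le> N - 1"
  shows "Pc j < Pc i"
proof -
  have "Pc j < - a j" using assms by (intro Pc_strict) auto
  also have "- a j \<le> - a (i + 1)" using assms by (auto intro: a_mono)
  also have "\<dots> < Pc i" using assms by (intro Pc_strict) auto
  finally show ?thesis .
qed

lemma Pc_antimono: "1 \<le> i \<Longrightarrow> i \<le> j \<Longrightarrow> j \<le> N - 1 \<Longrightarrow> Pc j \<le> Pc i"
  using Pc_less[of i j] by (cases "i = j") auto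

lemma disjoint_cells: "disjoint_family_on cell {1..N}"
proof -
  have "x \<notin> cell j" if "i \<in> {1..N}" "j \<in> {1..N}" "i < j" "x \<in> cell i" for i j x
  proof
    assume "x \<in> cell j"
    then have "Pc i < x" "x < Pc (j - 1)" using that by (auto simp: cell_def)
    moreover have "Pc (j - 1) \<le> Pc i"
      using that by (intro Pc_antimono) auto
    ultimately show False by simp
  qed
  then show ?thesis unfolding disjoint_family_on_def by (metis disjoint_iff linorder_neqE_nat)
qed

text \<open>Since \<open>Pc p\<close> lies between the neighbouring poles \<open>- a (p + 1)\<close>
  and \<open>- a p\<close>, exactly the first \<open>p\<close> factors are negative there.\<close>

lemma sgn_Q_Pc:
  assumes p: "p \<in> {1..N - 1}"
  shows "(-1) ^ p * Q (Pc p) > 0"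
  unfolding Q_def
proof (rule sgn_prod_shift)
  fix k assume "k \<in> {1..p}"
  then have "a k \<le> a p" using p by (auto intro: a_mono)
  then show "Pc p + a k < 0" using Pc_strict[OF p] by simp
next
  fix k assume "k \<in> {p + 1..N}"
  then have "a (p + 1) \<le> a k" using p by (auto intro: a_mono)
  then show "Pc p + a k > 0" using Pc_strict[OF p] by simp
qed (use p in auto)

lemma sgn_H_Pc:
  assumes p: "p \<in> {1..N - 1}"
  shows "(-1) ^ p * H (Pc p) < 0"
proof -
  have "(-1) ^ p * H (Pc p) = - V * ((-1) ^ p * Q (Pc p))"
    by (simp add: H_def Pc_root[OF p])
  then show ?thesis using sgn_Q_Pc[OF p] V_pos by (simp add: mult_pos_neg)
qed

section \<open>Signs of \<open>H\<close> far to the right and far to the left\<close>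

lemma H_eq_Q_mult:
  assumes "Q x \<noteq> 0"
  shows "H x = Q x * ((\<Sum>q = 1..N. (x + K) * w q / (x + a q)) - V)"
  unfolding H_def G_eq_Q_mult[OF assms]
  by (simp add: algebra_simps sum_distrib_left)

text \<open>Each summand tends to \<open>w q\<close> whatever \<open>K\<close> is, so the limit is
  the sum of the weights minus \<open>V\<close>, which \<open>V_gt\<close> makes negative.\<close>

lemma eventually_quotient_neg:
  "\<forall>\<^sub>F x in at_top. (\<Sum>q = 1..N. (x + K) * w q / (x + a q)) - V < 0"
  "\<forall>\<^sub>F x in at_bot. (\<Sum>q = 1..N. (x + K) * w q / (x + a q)) - V < 0"
proof -
  have top: "((\<lambda>x. (x + K) * w q / (x + a q)) \<longlongrightarrow> w q) at_top" if "w q > 0" for q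
    using that by real_asymp
  have bot: "((\<lambda>x. (x + K) * w q / (x + a q)) \<longlongrightarrow> w q) at_bot" if "w q > 0" for q
    using that by real_asymp
  have "((\<lambda>x. (\<Sum>q = 1..N. (x + K) * w q / (x + a q)) - V) \<longlongrightarrow> (\<Sum>q = 1..N. w q) - V) at_top"
    by (intro tendsto_intros top w_pos)
  then show "\<forall>\<^sub>F x in at_top. (\<Sum>q = 1..N. (x + K) * w q / (x + a q)) - V < 0"
    by (rule order_tendstoD(2)) (use V_gt in simp)
  have "((\<lambda>x. (\<Sum>q = 1..N. (x + K) * w q / (x + a q)) - V) \<longlongrightarrow> (\<Sum>q = 1..N. w q) - V) at_bot"
    by (intro tendsto_intros bot w_pos)
  then show "\<forall>\<^sub>F x in at_bot. (\<Sum>q = 1..N. (x + K) * w q / (x + a q)) - V < 0"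
    by (rule order_tendstoD(2)) (use V_gt in simp)
qed

text \<open>Right of \<open>- a 1\<close>, the largest pole, all factors of \<open>Q\<close> are
  positive. The point found continues the sign pattern of \<open>sgn_H_Pc\<close> to index
  0.\<close>

lemma H_neg_right: "\<exists>x > Pc 1. H x < 0"
proof -
  have "\<forall>\<^sub>F x in at_top. Pc 1 < x \<and> - a 1 < x
      \<and> (\<Sum>q = 1..N. (x + K) * w q / (x + a q)) - V < 0"
    using eventually_quotient_neg(1) by (intro eventually_conj eventually_gt_at_top)
  then obtain x where x: "Pc 1 < x" "- a 1 < x"
    "(\<Sum>q = 1..N. (x + K) * w q / (x + a q)) - V < 0"
    using eventually_happens[of _ "at_top :: real filter"] by auto
  have "(-1) ^ 0 * Q x > 0"
    unfolding Q_def
  proof (rule sgn_prod_shift)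
    fix k assume "k \<in> {0 + 1..N}"
    then have "a 1 \<le> a k" by (auto intro: a_mono)
    then show "x + a k > 0" using x(2) by simp
  qed auto
  then have "H x < 0" using x(3) by (simp add: H_eq_Q_mult mult_pos_neg)
  then show ?thesis using x(1) by blast
qed

text \<open>Left of \<open>- a N\<close>, the smallest pole, all \<open>N\<close> factors of
  \<open>Q\<close> are negative. The point found continues the sign pattern to index
  \<open>N\<close>.\<close>

lemma sgn_H_left: "\<exists>x < Pc (N - 1). (-1) ^ N * H x < 0"
proof -
  have "\<forall>\<^sub>F x in at_bot. x < Pc (N - 1) \<and> x < - a N
      \<and> (\<Sum>q = 1..N. (x + K) * w q / (x + a q)) - V < 0"
    using eventually_quotient_neg(2) by (intro eventually_conj eventually_gt_at_bot)
  then obtain x where x: "x < Pc (N - 1)" "x < - a N"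
    "(\<Sum>q = 1..N. (x + K) * w q / (x + a q)) - V < 0"
    using eventually_happens[of _ "at_bot :: real filter"] by auto
  have pos: "(-1) ^ N * Q x > 0"
    unfolding Q_def
  proof (rule sgn_prod_shift)
    fix k assume "k \<in> {1..N}"
    then have "a k \<le> a N" by (auto intro: a_mono)
    then show "x + a k < 0" using x(2) by simp
  qed auto
  then have "Q x \<noteq> 0" by auto
  then have "(-1) ^ N * H x
      = ((-1) ^ N * Q x) * ((\<Sum>q = 1..N. (x + K) * w q / (x + a q)) - V)"
    by (simp add: H_eq_Q_mult)
  then have "(-1) ^ N * H x < 0" using mult_pos_neg[OF pos x(3)] by (simp only:)
  then show ?thesis using x(1) by blast
qed

section \<open>Existence, count and uniqueness of the roots\<close>

lemma H_root_between:
  assumes "x < y" and "(-1) ^ Suc p * H x < 0" and "(-1) ^ p * H y < 0"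
  shows "\<exists>z. x < z \<and> z < y \<and> H z = 0"
proof -
  have "H x * H y < 0"
    using assms(2,3) by (cases "even p") (auto simp: mult_less_0_iff)
  then show ?thesis
    using poly_IVT[OF assms(1), of H_poly] by (simp add: poly_H_poly)
qed

lemma H_root_in_cell:
  assumes p: "p \<in> {1..N}"
  shows "\<exists>x. x \<in> {x. H x = 0} \<inter> cell p"
proof -
  obtain r where r: "p = Suc r" using p by (cases p) auto
  \<comment> \<open>The left end \<open>x\<close> carries the sign of index \<open>p\<close> and the
    right end \<open>y\<close> that of index \<open>r = p - 1\<close>. In an unbounded interval a
    far point replaces the missing critical pressure.\<close>
  have "\<exists>x. (-1) ^ p * H x < 0 \<and> (if p < N then x = Pc p else x < Pc (N - 1))"
    using sgn_H_Pc[of p] sgn_H_left p by (cases "p < N") (force, force)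
  then obtain x where x: "(-1) ^ p * H x < 0" "if p < N then x = Pc p else x < Pc (N - 1)"
    by blast
  have "\<exists>y. (-1) ^ r * H y < 0 \<and> (if 1 < p then y = Pc (p - 1) else y > Pc 1)"
    using sgn_H_Pc[of r] H_neg_right p r by (cases "1 < p") (force, force)
  then obtain y where y: "(-1) ^ r * H y < 0" "if 1 < p then y = Pc (p - 1) else y > Pc 1"
    by blast
  have "x < y"
  \<comment> \<open>As \<open>N\<close> is at least 2, at most one of the two ends is a far point,
    and the other is then the critical pressure that it is compared with.\<close>
  proof (cases "p = 1 \<or> p = N")
    case True
    then show ?thesis using x(2) y(2) N_ge_2 p by (auto split: if_splits)
  next
    case False
    then show ?thesis using x(2) y(2) p Pc_less[of "p - 1" p] by auto
  qed
  then obtain z where "x < z" "z < y" "H z = 0"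
    using H_root_between[of x y r] x(1) y(1) r by blast
  then show ?thesis using x(2) y(2) by (auto simp: cell_def split: if_splits)
qed

lemma H_roots:
  "card {x. H x = 0} = N" "\<And>p. p \<in> {1..N} \<Longrightarrow> \<exists>!x. x \<in> {x. H x = 0} \<inter> cell p"
proof -
  \<comment> \<open>A nonzero value rules out the zero polynomial, so the degree bounds the number
    of roots.\<close>
  obtain x where "H x < 0" using H_neg_right by blast
  then have "H_poly \<noteq> 0" using poly_H_poly[of x] by auto
  then have fin: "finite {x. H x = 0}" and card: "card {x. H x = 0} \<le> card {1..N}"
    using poly_roots_finite[of H_poly] card_poly_roots_bound[of H_poly] degree_H_poly
    by (simp_all add: poly_H_poly)
  note * = card_roots_eq_and_unique_per_set[where A = "{1..N}" and I = cell,
      OF _ fin card H_root_in_cell disjoint_cells]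
  show "card {x. H x = 0} = N" using *(1) by simp
  show "\<exists>!x. x \<in> {x. H x = 0} \<inter> cell p" if "p \<in> {1..N}" for p
    using *(2) that by simp
qed

text \<open>The \<open>N - 1\<close> values \<open>Pc p\<close> are distinct and exhaust the degree
  bound for \<open>G_poly\<close>.\<close>

lemma G_roots: "{x. G x = 0} = Pc ` {1..N - 1}"
proof -
  have "G_poly \<noteq> 0" using poly_G_poly[of "- a 1"] G_neq_0_at_pole[of 1] N_ge_2 by auto
  then have fin: "finite {x. G x = 0}" and card: "card {x. G x = 0} \<le> N - 1"
    using poly_roots_finite[of G_poly] card_poly_roots_bound[of G_poly] degree_G_poly
    by (simp_all add: poly_G_poly)
  have inj: "inj_on Pc {1..N - 1}"
  proof (rule linorder_inj_onI')
    fix i j assume "i \<in> {1..N - 1}" "j \<in> {1..N - 1}" "i < j"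
    then show "Pc i \<noteq> Pc j" using Pc_less[of i j] by auto
  qed
  have "Pc ` {1..N - 1} = {x. G x = 0}"
    using Pc_root card card_image[OF inj] by (intro card_seteq fin) auto
  then show ?thesis ..
qed

text \<open>Ensures that \<open>F_PT\<close> is a genuine quotient throughout each interval, so that
  no zero of it can stem from the convention for division by zero.\<close>

lemma G_neq_0_in_cell:
  assumes p: "p \<in> {1..N}" and x: "x \<in> cell p"
  shows "G x \<noteq> 0"
proof
  assume "G x = 0"
  then obtain i where i: "i \<in> {1..N - 1}" "x = Pc i" using G_roots by blast
  show False
  proof (cases "i < p")
    case True
    then have "Pc (p - 1) \<le> Pc i" using i(1) p by (intro Pc_antimono) auto
    then show False using x True i by (auto simp: cell_def)
  next
    case False
    then have "Pc i \<le> Pc p" using i(1) p by (intro Pc_antimono) auto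
    then show False using x False i p by (auto simp: cell_def)
  qed
qed

end

section \<open>Transfer to the mixture functions\<close>

lemma N_PT_eq:
  "N_PT N \<alpha> \<rho> \<gamma> CV Pinf x =
    (\<Sum>q = 1..N. \<gamma> q * CV q * (\<alpha> q * \<rho> q)) * (\<Prod>k = 1..N. x + Pinf k)
      - x * G_PT N \<alpha> \<rho> \<gamma> CV Pinf x"
proof -
  have "((x + Pinf q) + (\<gamma> q - 1) * Pinf q) * CV q * (\<alpha> q * \<rho> q)
        * (\<Prod>k \<in> {1..N} - {q}. x + Pinf k)
      = \<gamma> q * CV q * (\<alpha> q * \<rho> q) * (\<Prod>k = 1..N. x + Pinf k)
        - x * (CV q * (\<gamma> q - 1) * (\<alpha> q * \<rho> q) * (\<Prod>k \<in> {1..N} - {q}. x + Pinf k))"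
    if "q \<in> {1..N}" for q
    using prod.remove[OF _ that, of "\<lambda>k. x + Pinf k"] by (simp add: algebra_simps)
  then show ?thesis
    unfolding N_PT_def G_PT_def
    by (simp add: sum_subtractf sum_distrib_left sum_distrib_right)
qed

text \<open>The assumptions \<open>masses_nonzero\<close> and \<open>P_min_distinct\<close> make the
  weights positive and the shifts strictly increasing; otherwise \<open>G_PT\<close> and the product
  of all shifts would share a zero. The count excludes zeros of \<open>G_PT\<close>, where
  \<open>F_PT\<close> has only a conventional value.\<close>

theorem theorem3p6:
  fixes N :: nat
    and \<alpha> \<rho> \<gamma> CV P Pinf Pc :: "nat \<Rightarrow> real"
  assumes "N \<ge> 2"
    and "\<And>q. q \<in> {1..N} \<Longrightarrow> \<alpha> q * \<rho> q \<ge> 0"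
    and "\<And>q. q \<in> {1..N} \<Longrightarrow> 0 \<le> \<alpha> q \<and> \<alpha> q \<le> 1"
    and "(\<Sum>q = 1..N. \<alpha> q) = 1"
    and "\<And>q. q \<in> {1..N} \<Longrightarrow> \<gamma> q > 1"
    and "\<And>q. q \<in> {1..N} \<Longrightarrow> CV q > 0"
    and "\<And>q. q \<in> {1..N} \<Longrightarrow> P q \<ge> P_min Pinf q"
    and ordered: "\<And>p. p \<in> {1..N - 1} \<Longrightarrow> P_min Pinf p \<ge> P_min Pinf (p + 1)"
    and masses_nonzero: "\<And>q. q \<in> {1..N} \<Longrightarrow> \<alpha> q * \<rho> q \<noteq> 0"
    and P_min_distinct: "inj_on (P_min Pinf) {1..N}"
    and Pc_range: "\<And>p. p \<in> {1..N - 1} \<Longrightarrow> Pc p \<in> {P_min Pinf (p + 1)..P_min Pinf p}"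
    and Pc_root: "\<And>p. p \<in> {1..N - 1} \<Longrightarrow> G_PT N \<alpha> \<rho> \<gamma> CV Pinf (Pc p) = 0"
  shows "card {x. G_PT N \<alpha> \<rho> \<gamma> CV Pinf x \<noteq> 0 \<and> F_PT N \<alpha> \<rho> \<gamma> CV P Pinf x = 0} = N
    \<and> (\<exists>!x. x \<in> {..<Pc (N - 1)} \<and> F_PT N \<alpha> \<rho> \<gamma> CV P Pinf x = 0)
    \<and> (\<forall>p\<in>{1..N - 2}. \<exists>!x. x \<in> {Pc (p + 1)<..<Pc p} \<and> F_PT N \<alpha> \<rho> \<gamma> CV P Pinf x = 0)
    \<and> (\<exists>!x. x \<in> {Pc 1<..} \<and> F_PT N \<alpha> \<rho> \<gamma> CV P Pinf x = 0)"
proof -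
  define K where "K = (\<Sum>q = 1..N. ((P q + Pinf q) + (\<gamma> q - 1) * Pinf q) / (\<gamma> q - 1) * \<alpha> q)"
  define V where "V = (\<Sum>q = 1..N. \<gamma> q * CV q * (\<alpha> q * \<rho> q))"
  define w where "w = (\<lambda>q. CV q * (\<gamma> q - 1) * (\<alpha> q * \<rho> q))"
  let ?G = "G_PT N \<alpha> \<rho> \<gamma> CV Pinf" and ?F = "F_PT N \<alpha> \<rho> \<gamma> CV P Pinf"
  have mass: "\<alpha> q * \<rho> q > 0" if "q \<in> {1..N}" for q
    using assms(2)[OF that] masses_nonzero[OF that] by linarith
  \<comment> \<open>Distinctness makes the weak ordering strict, and the sign in
    \<open>P_min\<close> reverses it.\<close>
  have step: "Pinf p < Pinf (Suc p)" if "1 \<le> p" "p < N" for p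
    using that ordered[of p] inj_onD[OF P_min_distinct, of p "Suc p"]
    by (force simp: P_min_def)
  have Pinf_less: "Pinf i < Pinf j" if "1 \<le> i" "i < j" "j \<le> N" for i j
    using that(2,3)
  proof (induction j)
    case (Suc j)
    then show ?case using step[of j] that(1) by (cases "i = j") auto
  qed simp
  interpret W: weighted_shifts N Pinf w
  proof
    show "w q > 0" if "q \<in> {1..N}" for q
      unfolding w_def using assms(5,6)[OF that] mass[OF that] by simp
  qed (use assms(1) Pinf_less in auto)
  have G: "W.G = ?G"
    by (rule ext) (simp only: W.G_def G_PT_def, simp only: w_def)
  interpret W: weighted_shifts_roots N Pinf w Pc V K
  proof
    show "Pc p \<in> {- Pinf (p + 1)..- Pinf p}" if "p \<in> {1..N - 1}" for p
      using Pc_range[OF that] by (simp add: P_min_def)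
    show "W.G (Pc p) = 0" if "p \<in> {1..N - 1}" for p
      using Pc_root[OF that] G by simp
    \<comment> \<open>The two sides differ by \<open>CV q\<close> times the mass, which is
      positive.\<close>
    have "w q < \<gamma> q * CV q * (\<alpha> q * \<rho> q)" if "q \<in> {1..N}" for q
      using mult_pos_pos[OF assms(6)[OF that] mass[OF that]]
      by (simp add: w_def algebra_simps)
    then show "V > (\<Sum>q = 1..N. w q)"
      unfolding V_def using assms(1) by (intro sum_strict_mono) auto
  qed
  have F_eq: "?F x = (V * W.Q x - x * ?G x) / ?G x - K" for x
    unfolding F_PT_def N_PT_eq W.Q_def K_def V_def ..
  \<comment> \<open>Multiplying \<open>F_PT\<close> by \<open>G_PT\<close> gives
    \<open>- W.H x\<close>.\<close>
  have F: "?F x = 0 \<longleftrightarrow> W.H x = 0" if "?G x \<noteq> 0" for x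
    unfolding F_eq W.H_def G using that by (auto simp: field_simps)
  have "{x. ?G x \<noteq> 0 \<and> ?F x = 0} = {x. W.H x = 0}"
    using F W.H_eq_0D G by auto
  then have card: "card {x. ?G x \<noteq> 0 \<and> ?F x = 0} = N"
    using W.H_roots(1) by simp
  have unique: "\<exists>!x. x \<in> W.cell p \<and> ?F x = 0" if "p \<in> {1..N}" for p
  proof -
    have "x \<in> {x. W.H x = 0} \<inter> W.cell p \<longleftrightarrow> x \<in> W.cell p \<and> ?F x = 0" for x
      using F W.G_neq_0_in_cell[OF that] G by auto
    then show ?thesis using W.H_roots(2)[OF that] by simp
  qed
  \<comment> \<open>The inner interval between \<open>Pc (p + 1)\<close> and \<open>Pc p\<close> is
    the cell with index \<open>p + 1\<close>.\<close>
  have cells: "W.cell N = {..<Pc (N - 1)}" "W.cell 1 = {Pc 1<..}"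
    "\<And>p. p \<in> {1..N - 2} \<Longrightarrow> W.cell (p + 1) = {Pc (p + 1)<..<Pc p}"
    using assms(1) by (auto simp: W.cell_def)
  show ?thesis
  proof (intro conjI ballI)
    show "\<exists>!x. x \<in> {..<Pc (N - 1)} \<and> ?F x = 0"
      using unique[of N] assms(1) unfolding cells by simp
    show "\<exists>!x. x \<in> {Pc (p + 1)<..<Pc p} \<and> ?F x = 0" if p: "p \<in> {1..N - 2}" for p
    proof -
      have "p + 1 \<in> {1..N}" using p by auto
      from unique[OF this] show ?thesis unfolding cells(3)[OF p] .
    qed
    show "\<exists>!x. x \<in> {Pc 1<..} \<and> ?F x = 0"
      using unique[of 1] assms(1) unfolding cells by simp
  qed (rule card)
qed

end
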